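(* Let $k\ge1$ and let $f:D\to\Lambda\times\mathbb{R}^u\times\mathbb{R}^s$ be a $C^{k+1}$ map satisfying the covering conditions, the rate conditions of order $k$ and the backward cone conditions (so that for each $z\in W^{cu}$ the unstable fiber $W^u_z$ equals $\{(\pi_\lambda w^u_z(x),x,\pi_yw^u_z(x)):x\in\overline B_u(R)\}$ for a function $w^u_z:\overline B_u(R)\to\Lambda\times\overline B_s(R)$). Let $M\in(0,1/L)$ and $\xi=\inf_{z\in D}m([\partial f_x/\partial x(P(z))])-M\sup_{z\in D}\|\partial f_x/\partial(\lambda,y)(z)\|$, $\mu=\sup_{z\in D}\{\|\partial f_{(\lambda,y)}/\partial(\lambda,y)(z)\|+\frac1M\|\partial f_{(\lambda,y)}/\partial x(z)\|\}$. If $\xi/\mu>1$, then for every $z\in W^{cu}$ the function $w^u_z$ is Lipschitz with constant $M$.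
   Context: Same setting and definitions as follows. $c,u,s$ positive integers, $\Lambda=(\mathbb{R}/\mathbb{Z})^c$, $R_\Lambda=\tfrac12$; points are "in the same chart" if their $\lambda$-components have lifts to $\mathbb{R}^c$ at distance $\le R_\Lambda$, and differences, norms, cones, derivatives are computed in such lifts; $\overline B_c(\lambda,R_\Lambda)$ closed ball about a lift of $\lambda$. $B_n(R),\overline B_n(R)$ open/closed balls at $0$; Euclidean norms. $0<R<R_\Lambda/2$, $D=\Lambda\times\overline B_u(R)\times\overline B_s(R)$, $z=(\lambda,x,y)$, projections $\pi_\lambda,\pi_x,\pi_y,\pi_{(\lambda,x)},\pi_{(\lambda,y)}$, $f=(f_\lambda,f_x,f_y)$. $m(A)=\max\{c:\|Av\|\ge c\|v\|\}$, $m(\mathbf A)=\inf_{A\in\mathbf A}m(A)$; $[\partial g/\partial w(U)]$ = matrices with $(i,j)$ entry in $[\inf_U\partial g_i/\partial w_j,\sup_U\partial g_i/\partial w_j]$; $P(z)=\{w\in D:\|\pi_\lambda w-\pi_\lambda z\|\le R_\Lambda/2\}$. Fix $L\in(2R/R_\Lambda,1)$; constants $\mu_{s,1}=\sup_{D}\{\|\partial_y f_y\|+\frac1L\|\partial_{(\lambda,x)}f_y\|\}$, $\mu_{s,2}=\sup_D\{\|\partial_yf_y\|+L\|\partial_yf_{(\lambda,x)}\|\}$, $\xi_{u,1}=\inf_D\{m(\partial_xf_x)-\frac1L\|\partial_{(\lambda,y)}f_x\|\}$, $\xi_{u,1,P}=\inf_{z\in D}m[\partial_xf_x(P(z))]-\frac1L\sup_D\|\partial_{(\lambda,y)}f_x\|$,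 $\xi_{u,2}=\inf_D\{m(\partial_xf_x)-L\|\partial_xf_{(\lambda,y)}\|\}$, $\mu_{cs,1}=\sup_D\{\|\partial_{(\lambda,y)}f_{(\lambda,y)}\|+L\|\partial_xf_{(\lambda,y)}\|\}$, $\mu_{cs,2}=\sup_D\{\|\partial_{(\lambda,y)}f_{(\lambda,y)}\|+\frac1L\|\partial_{(\lambda,y)}f_x\|\}$, $\xi_{cu,1}=\inf_D\{m(\partial_{(\lambda,x)}f_{(\lambda,x)})-L\|\partial_yf_{(\lambda,x)}\|\}$, $\xi_{cu,1,P}=\inf_{z\in D}m[\partial_{(\lambda,x)}f_{(\lambda,x)}(P(z))]-L\sup_D\|\partial_yf_{(\lambda,x)}\|$, $\xi_{cu,2}=\inf_D\{m(\partial_{(\lambda,x)}f_{(\lambda,x)})-\frac1L\|\partial_{(\lambda,x)}f_y\|\}$. Rate conditions of order $k$: all $\xi$'s positive; $\mu_{s,1}<1<\xi_{u,1,P}$; $\mu_{cs,1}<\xi_{u,1,P}$; $\mu_{s,1}<\xi_{cu,1,P}$; for $1\le j\le k$: $\mu_{cs,1}^{j+1}<\xi_{u,2}$, $\mu_{s,2}<\xi_{cu,1}^{j+1}$; $\mu_{cs,2}<\xi_{u,1}$; $\mu_{s,1}<\xi_{cu,2}$. Cones $J_s(z,M)=\{\|(\lambda,x)-\pi_{(\lambda,x)}z\|\le M\|y-\pi_yz\|\}$, $J_u(z,M)=\{\|(\lambda,y)-\pi_{(\lambda,y)}z\|\le M\|x-\pi_xz\|\}$. A backward trajectory of $z$: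 $\{z_i\}_{i\le0}$, $z_0=z$, $f(z_{i-1})=z_i$. $W^{cu}=\{z:$ there is a full backward trajectory of $z$ in $D\}$. For $z\in W^{cu}$: $W^u_z=\{p\in D:$ $p$ has a backward trajectory in $D$ and for any backward trajectories $\{p_i\}$ of $p$ and $\{z_i\}$ of $z$ in $D$, $p_i\in J_u(z_i,1/L)\cap D$ for all $i\le0\}$. Backward cone conditions: if $z_1,z_2,f(z_1),f(z_2)\in D$ and $f(z_1)\in J_s(f(z_2),1/L)$ then $z_1\in J_s(z_2,1/L)$. Covering conditions: with $D_\lambda=\overline B_c(\lambda,R_\Lambda)\times\overline B_u(R)\times\overline B_s(R)$, $D^+_\lambda=\overline B_c(\lambda,R_\Lambda)\times\overline B_u(R)\times\partial B_s(R)$, $D^-_\lambda=\overline B_c(\lambda,R_\Lambda)\times\partial B_u(R)\times B_s(R)$: for each $z\in D$ there exist $\lambda^*$, a homotopy $h:[0,1]\times U\to B_c(\lambda^*,R_\Lambda)\times\mathbb{R}^u\times\mathbb{R}^s$ ($U=J_u(z,1/L)\cap D$) and linear $A$ with $h_0=f|_U$, $h_\alpha(U\cap D^-_{\pi_\lambda z})\cap D_{\lambda^*}=\emptyset$, $h_\alpha(U)\cap D^+_{\lambda^*}=\emptyset$ for all $\alpha\in[0,1]$, $h_1(\lambda,x,y)=(\lambda^*,Ax,0)$, $A(\partial B_u(R))\subset\mathbb{R}^u\setminus\overline B_u(R)$. *)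

theory Defs
  imports "HOL-Analysis.Analysis"
begin

text \<open>Points of the lifted phase space: a lift in R^c of a point of the torus
  Lambda = (R/Z)^c, together with x in R^u and y in R^s.  The map f on
  D = Lambda x cball_u(R) x cball_s(R) is represented by a lift F.\<close>

type_synonym ('c,'u,'s) pt = "(real^'c) \<times> (real^'u) \<times> (real^'s)"

definition lam :: "('c::finite,'u::finite,'s::finite) pt \<Rightarrow> real^'c" where "lam p = fst p"
definition xc :: "('c::finite,'u::finite,'s::finite) pt \<Rightarrow> real^'u" where "xc p = fst (snd p)"
definition yc :: "('c::finite,'u::finite,'s::finite) pt \<Rightarrow> real^'s" where "yc p = snd (snd p)"

definition intvec :: "real^'c \<Rightarrow> bool" where "intvec n \<longleftrightarrow> (\<forall>i. n $ i \<in> \<int>)"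
definition tor_eq :: "real^'c \<Rightarrow> real^'c \<Rightarrow> bool" where "tor_eq a b \<longleftrightarrow> intvec (a - b)"
definition pt_eq :: "('c::finite,'u::finite,'s::finite) pt \<Rightarrow> ('c,'u,'s) pt \<Rightarrow> bool" where
  "pt_eq p q \<longleftrightarrow> tor_eq (lam p) (lam q) \<and> xc p = xc q \<and> yc p = yc q"

text \<open>lifted domain D (R_Lambda = 1/2)\<close>
definition Dset :: "real \<Rightarrow> ('c::finite,'u::finite,'s::finite) pt set" where
  "Dset R = UNIV \<times> cball 0 R \<times> cball 0 R"

definition is_lift :: "real \<Rightarrow> (('c::finite,'u::finite,'s::finite) pt \<Rightarrow> ('c,'u,'s) pt) \<Rightarrow> bool" where
  "is_lift R F \<longleftrightarrow> (\<forall>p\<in>Dset R. \<forall>n. intvec n \<longrightarrow>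
      pt_eq (F (lam p + n, xc p, yc p)) (F p))"

text \<open>C^k on a set (meant for open sets): all iterated directional derivatives exist and are continuous\<close>
fun Ck :: "nat \<Rightarrow> ('a::euclidean_space \<Rightarrow> 'b::real_normed_vector) \<Rightarrow> 'a set \<Rightarrow> bool" where
  "Ck 0 f S = continuous_on S f"
| "Ck (Suc n) f S = (f differentiable_on S \<and> (\<forall>v. Ck n (\<lambda>z. frechet_derivative f (at z) v) S))"

definition Ck_on_D :: "nat \<Rightarrow> real \<Rightarrow> (('c::finite,'u::finite,'s::finite) pt \<Rightarrow> ('c,'u,'s) pt) \<Rightarrow> bool" where
  "Ck_on_D k R F \<longleftrightarrow> (\<exists>S. open S \<and> Dset R \<subseteq> S \<and> Ck k F S)"

definition pl :: "('c::finite,'u::finite,'s::finite) pt \<Rightarrow> real^'c" where "pl v = fst v"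
definition px :: "('c::finite,'u::finite,'s::finite) pt \<Rightarrow> real^'u" where "px v = fst (snd v)"
definition py :: "('c::finite,'u::finite,'s::finite) pt \<Rightarrow> real^'s" where "py v = snd (snd v)"
definition plx :: "('c::finite,'u::finite,'s::finite) pt \<Rightarrow> (real^'c) \<times> (real^'u)" where "plx v = (fst v, fst (snd v))"
definition ply :: "('c::finite,'u::finite,'s::finite) pt \<Rightarrow> (real^'c) \<times> (real^'s)" where "ply v = (fst v, snd (snd v))"
definition ix :: "real^'u \<Rightarrow> ('c::finite,'u::finite,'s::finite) pt" where "ix a = (0, a, 0)"
definition iy :: "real^'s \<Rightarrow> ('c::finite,'u::finite,'s::finite) pt" where "iy a = (0, 0, a)"
definition ilx :: "(real^'c) \<times> (real^'u) \<Rightarrow> ('c::finite,'u::finite,'s::finite) pt" where "ilx a = (fst a, snd a, 0)"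
definition ily :: "(real^'c) \<times> (real^'s) \<Rightarrow> ('c::finite,'u::finite,'s::finite) pt" where "ily a = (fst a, 0, snd a)"

definition blk :: "(('c::finite,'u::finite,'s::finite) pt \<Rightarrow> 'b) \<Rightarrow> ('a \<Rightarrow> ('c,'u,'s) pt)
     \<Rightarrow> (('c,'u,'s) pt \<Rightarrow> ('c,'u,'s) pt) \<Rightarrow> ('c,'u,'s) pt \<Rightarrow> 'a \<Rightarrow> 'b" where
  "blk P I F z = P \<circ> frechet_derivative F (at z) \<circ> I"

definition mmin :: "('a::euclidean_space \<Rightarrow> 'b::euclidean_space) \<Rightarrow> real" where
  "mmin A = Sup {c. \<forall>v. c * norm v \<le> norm (A v)}"

text \<open>interval matrix [dg/dw(U)]: linear maps whose (i,j) entry lies between inf_U and sup_U of dg_i/dw_j\<close>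
definition imat :: "('z \<Rightarrow> 'a::euclidean_space \<Rightarrow> 'b::euclidean_space) \<Rightarrow> 'z set \<Rightarrow> ('a \<Rightarrow> 'b) set" where
  "imat G U = {A. linear A \<and> (\<forall>i\<in>Basis. \<forall>j\<in>Basis.
       (INF w\<in>U. G w j \<bullet> i) \<le> A j \<bullet> i \<and> A j \<bullet> i \<le> (SUP w\<in>U. G w j \<bullet> i))}"

definition mmin_set :: "('a::euclidean_space \<Rightarrow> 'b::euclidean_space) set \<Rightarrow> real" where
  "mmin_set S = (INF A\<in>S. mmin A)"

text \<open>P(z) (R_Lambda/2 = 1/4), in the chart of the lift z\<close>
definition Pset :: "real \<Rightarrow> ('c::finite,'u::finite,'s::finite) pt \<Rightarrow> ('c,'u,'s) pt set" where
  "Pset R z = {w \<in> Dset R. norm (lam w - lam z) \<le> 1/4}"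

definition mu_s1 where "mu_s1 R L F = (SUP z\<in>Dset R. onorm (blk py iy F z) + (1/L) * onorm (blk py ilx F z))"
definition mu_s2 where "mu_s2 R L F = (SUP z\<in>Dset R. onorm (blk py iy F z) + L * onorm (blk plx iy F z))"
definition xi_u1 where "xi_u1 R L F = (INF z\<in>Dset R. mmin (blk px ix F z) - (1/L) * onorm (blk px ily F z))"
definition xi_u1P where "xi_u1P R L F = (INF z\<in>Dset R. mmin_set (imat (blk px ix F) (Pset R z)))
      - (1/L) * (SUP z\<in>Dset R. onorm (blk px ily F z))"
definition xi_u2 where "xi_u2 R L F = (INF z\<in>Dset R. mmin (blk px ix F z) - L * onorm (blk ply ix F z))"
definition mu_cs1 where "mu_cs1 R L F = (SUP z\<in>Dset R. onorm (blk ply ily F z) + L * onorm (blk ply ix F z))"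
definition mu_cs2 where "mu_cs2 R L F = (SUP z\<in>Dset R. onorm (blk ply ily F z) + (1/L) * onorm (blk px ily F z))"
definition xi_cu1 where "xi_cu1 R L F = (INF z\<in>Dset R. mmin (blk plx ilx F z) - L * onorm (blk plx iy F z))"
definition xi_cu1P where "xi_cu1P R L F = (INF z\<in>Dset R. mmin_set (imat (blk plx ilx F) (Pset R z)))
      - L * (SUP z\<in>Dset R. onorm (blk plx iy F z))"
definition xi_cu2 where "xi_cu2 R L F = (INF z\<in>Dset R. mmin (blk plx ilx F z) - (1/L) * onorm (blk py ilx F z))"

definition rate_conditions :: "nat \<Rightarrow> real \<Rightarrow> real \<Rightarrow> (('c::finite,'u::finite,'s::finite) pt \<Rightarrow> ('c,'u,'s) pt) \<Rightarrow> bool" where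
  "rate_conditions k R L F \<longleftrightarrow>
     xi_u1 R L F > 0 \<and> xi_u1P R L F > 0 \<and> xi_u2 R L F > 0 \<and>
     xi_cu1 R L F > 0 \<and> xi_cu1P R L F > 0 \<and> xi_cu2 R L F > 0 \<and>
     mu_s1 R L F < 1 \<and> 1 < xi_u1P R L F \<and>
     mu_cs1 R L F < xi_u1P R L F \<and> mu_s1 R L F < xi_cu1P R L F \<and>
     (\<forall>j\<in>{1..k}. mu_cs1 R L F ^ (j+1) < xi_u2 R L F \<and> mu_s2 R L F < xi_cu1 R L F ^ (j+1)) \<and>
     mu_cs2 R L F < xi_u1 R L F \<and> mu_s1 R L F < xi_cu2 R L F"

text \<open>cones: w in J(z,M), computed in a chart (lifts of lambda at distance <= 1/2)\<close>
definition Js :: "('c::finite,'u::finite,'s::finite) pt \<Rightarrow> real \<Rightarrow> ('c,'u,'s) pt \<Rightarrow> bool" where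
  "Js z M w \<longleftrightarrow> (\<exists>n. intvec n \<and> norm (lam w + n - lam z) \<le> 1/2 \<and>
      norm (lam w + n - lam z, xc w - xc z) \<le> M * norm (yc w - yc z))"
definition Ju :: "('c::finite,'u::finite,'s::finite) pt \<Rightarrow> real \<Rightarrow> ('c,'u,'s) pt \<Rightarrow> bool" where
  "Ju z M w \<longleftrightarrow> (\<exists>n. intvec n \<and> norm (lam w + n - lam z) \<le> 1/2 \<and>
      norm (lam w + n - lam z, yc w - yc z) \<le> M * norm (xc w - xc z))"

definition backward_cone_conditions :: "real \<Rightarrow> real \<Rightarrow> (('c::finite,'u::finite,'s::finite) pt \<Rightarrow> ('c,'u,'s) pt) \<Rightarrow> bool" where
  "backward_cone_conditions R L F \<longleftrightarrow> (\<forall>z1\<in>Dset R. \<forall>z2\<in>Dset R.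
      F z1 \<in> Dset R \<longrightarrow> F z2 \<in> Dset R \<longrightarrow> Js (F z2) (1/L) (F z1) \<longrightarrow> Js z2 (1/L) z1)"

text \<open>covering conditions, written in the chart around the lift z of a point of D\<close>
definition covering_conditions :: "real \<Rightarrow> real \<Rightarrow> (('c::finite,'u::finite,'s::finite) pt \<Rightarrow> ('c,'u,'s) pt) \<Rightarrow> bool" where
  "covering_conditions R L F \<longleftrightarrow> (\<forall>z\<in>Dset R.
     (let U = {w \<in> Dset R. norm (lam w - lam z) \<le> 1/2 \<and>
                 norm (lam w - lam z, yc w - yc z) \<le> (1/L) * norm (xc w - xc z)};
          Dminus = cball (lam z) (1/2) \<times> sphere 0 R \<times> ball 0 R
      in \<exists>(lst::real^'c) (h::real \<times> ('c,'u,'s) pt \<Rightarrow> ('c,'u,'s) pt) (A::real^'u \<Rightarrow> real^'u).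
        continuous_on ({0..1} \<times> U) h \<and>
        h ` ({0..1} \<times> U) \<subseteq> ball lst (1/2) \<times> UNIV \<and>
        (\<forall>w\<in>U. pt_eq (h (0, w)) (F w)) \<and>
        (\<forall>\<alpha>\<in>{0..1}. \<forall>w\<in>U. w \<in> Dminus \<longrightarrow>
             h (\<alpha>, w) \<notin> cball lst (1/2) \<times> cball 0 R \<times> cball 0 R) \<and>
        (\<forall>\<alpha>\<in>{0..1}. \<forall>w\<in>U. h (\<alpha>, w) \<notin> cball lst (1/2) \<times> cball 0 R \<times> sphere 0 R) \<and>
        (\<forall>w\<in>U. h (1, w) = (lst, A (xc w), 0)) \<and>
        linear A \<and> A ` sphere 0 R \<subseteq> - cball 0 R))"

text \<open>backward trajectories in D (q n is a lift of z_{-n})\<close>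
definition back_traj :: "real \<Rightarrow> (('c::finite,'u::finite,'s::finite) pt \<Rightarrow> ('c,'u,'s) pt)
    \<Rightarrow> ('c,'u,'s) pt \<Rightarrow> (nat \<Rightarrow> ('c,'u,'s) pt) \<Rightarrow> bool" where
  "back_traj R F z q \<longleftrightarrow> pt_eq (q 0) z \<and> (\<forall>n. q n \<in> Dset R \<and> pt_eq (F (q (Suc n))) (q n))"

definition Wcu :: "real \<Rightarrow> (('c::finite,'u::finite,'s::finite) pt \<Rightarrow> ('c,'u,'s) pt) \<Rightarrow> ('c,'u,'s) pt set" where
  "Wcu R F = {z \<in> Dset R. \<exists>q. back_traj R F z q}"

definition Wu :: "real \<Rightarrow> real \<Rightarrow> (('c::finite,'u::finite,'s::finite) pt \<Rightarrow> ('c,'u,'s) pt)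
    \<Rightarrow> ('c,'u,'s) pt \<Rightarrow> ('c,'u,'s) pt set" where
  "Wu R L F z = {p \<in> Dset R. (\<exists>q. back_traj R F p q) \<and>
      (\<forall>q r. back_traj R F p q \<longrightarrow> back_traj R F z r \<longrightarrow> (\<forall>n. Ju (r n) (1/L) (q n)))}"

end

theory Submission
  imports Defs
begin

text \<open>Two points of an unstable fiber have backward orbits that approach a backward orbit of z at the
  rate xi = \<open>xi_u1P\<close>, hence each other. If far back they were not in each other's cone of width 1/L,
  they would stay outside it further back, and their center-stable distance could decay no faster
  than at the smaller rate \<open>mu_cs1\<close>: a contradiction. So they are in the 1/L-cone far back. Every cone of
  width K in [M, 1/L] is mapped by f into the cone of width theta K with a uniform theta < 1;
  iterating forward from the distant past shrinks the cone below width M.\<close>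

section \<open>Integer translations, the lifted domain and coordinate blocks\<close>

lemma tor_eq_refl: "tor_eq a a" by (simp add: tor_eq_def intvec_def)

lemma intvec_add: "intvec a \<Longrightarrow> intvec b \<Longrightarrow> intvec (a + b)"
  and intvec_diff: "intvec a \<Longrightarrow> intvec b \<Longrightarrow> intvec (a - b)"
  by (auto simp: intvec_def)

lemma intvec_eq_0:
  assumes "intvec n" "norm n < 1"
  shows "n = 0"
proof -
  have "n $ i = 0" for i
  proof -
    have "\<bar>n $ i\<bar> < 1" using component_le_norm_cart[of n i] assms(2) by linarith
    moreover have "n $ i \<in> \<int>" using assms(1) by (auto simp: intvec_def)
    ultimately show ?thesis by (auto elim!: Ints_cases)
  qed
  then show ?thesis by (simp add: vec_eq_iff)
qed

lemma convex_Dset: "convex (Dset R)"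
  unfolding Dset_def by (intro convex_Times convex_cball convex_UNIV)

lemma Dset_iff: "p \<in> Dset R \<longleftrightarrow> norm (xc p) \<le> R \<and> norm (yc p) \<le> R"
  by (cases p) (auto simp: Dset_def xc_def yc_def)

lemma linear_blocks:
  "linear (px :: ('c::finite,'u::finite,'s::finite) pt \<Rightarrow> _)"
  "linear (ply :: ('c,'u,'s) pt \<Rightarrow> _)"
  "linear (ix :: _ \<Rightarrow> ('c,'u,'s) pt)"
  "linear (ily :: _ \<Rightarrow> ('c,'u,'s) pt)"
  by (auto intro!: linearI simp: px_def ply_def ix_def ily_def)

lemma norm_blocks:
  "norm (px v) \<le> norm v" "norm (ply v) \<le> norm v" "norm (ix a) = norm a" "norm (ily b) = norm b"
proof -
  obtain l x y where v: "v = (l, x, y)" by (cases v)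
  show "norm (px v) \<le> norm v" "norm (ply v) \<le> norm v"
    by (auto simp: v px_def ply_def norm_Pair intro!: real_le_rsqrt)
  show "norm (ix a) = norm a" "norm (ily b) = norm b"
    by (cases b; auto simp: ix_def ily_def norm_Pair)+
qed

lemma block_split: "v = ily (ply v) + ix (px v)"
  by (cases v) (auto simp: ily_def ply_def ix_def px_def)

section \<open>The derivative of the lift: periodicity and a uniform bound\<close>

lemma continuous_on_frechet_derivative_of_Ck:
  assumes "Ck_on_D (k + 1) R F" "1 \<le> k"
  shows "\<And>z. z \<in> Dset R \<Longrightarrow> (F has_derivative frechet_derivative F (at z)) (at z)"
    and "continuous_on (Dset R) (\<lambda>z. frechet_derivative F (at z) v)"
proof -
  obtain S where S: "open S" "Dset R \<subseteq> S" "Ck (k+1) F S"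
    using assms(1) by (auto simp: Ck_on_D_def)
  \<comment> \<open>Since k >= 1, \<open>Ck (k + 1)\<close> unfolds twice. The second layer makes
    each directional derivative differentiable, and its continuity is read off from that.\<close>
  obtain k' where k: "k = Suc k'" using assms(2) by (cases k) auto
  have d: "F differentiable_on S" "(\<lambda>z. frechet_derivative F (at z) v) differentiable_on S"
    using S(3) by (simp_all add: k del: split_paired_All)
  show "(F has_derivative frechet_derivative F (at z)) (at z)" if "z \<in> Dset R" for z
    using that d(1) S(1,2) differentiable_on_eq_differentiable_at frechet_derivative_works by blast
  show "continuous_on (Dset R) (\<lambda>z. frechet_derivative F (at z) v)"
    using differentiable_imp_continuous_on[OF d(2)] S(2) continuous_on_subset by blast
qed

text \<open>The difference \<open>F (p + n) - F p\<close> is an integer vector in \<lambda> and zero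
  elsewhere, so by continuity it is constant on a connected set and its derivative vanishes. The
  argument runs on the interior of D, because \<open>is_lift\<close> controls F only on D and a
  two-sided derivative needs a full neighbourhood.\<close>

lemma frechet_derivative_periodic:
  fixes F :: "('c::finite,'u::finite,'s::finite) pt \<Rightarrow> ('c,'u,'s) pt"
  assumes lift: "is_lift R F"
    and der: "\<And>z. z \<in> Dset R \<Longrightarrow> (F has_derivative frechet_derivative F (at z)) (at z)"
    and n: "intvec n" and z: "z \<in> UNIV \<times> ball 0 R \<times> ball 0 R"
  shows "frechet_derivative F (at (z + (n, 0, 0))) = frechet_derivative F (at z)"
proof -
  let ?U = "UNIV \<times> ball 0 R \<times> ball 0 R :: ('c,'u,'s) pt set"
  let ?N = "(n, 0, 0) :: ('c,'u,'s) pt"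
  define H where "H p = F (p + ?N) - F p" for p
  have U: "open ?U" "connected ?U"
    by (auto intro!: open_Times connected_Times convex_connected)
  have sub: "p \<in> Dset R" "p + ?N \<in> Dset R" if "p \<in> ?U" for p
    using that by (auto simp: Dset_def)
  have Hd: "(H has_derivative (\<lambda>v. frechet_derivative F (at (p + ?N)) v - frechet_derivative F (at p) v)) (at p)"
    if "p \<in> ?U" for p
  proof -
    have "((\<lambda>p. F (p + ?N)) has_derivative (\<lambda>v. frechet_derivative F (at (p + ?N)) v)) (at p)"
      by (rule has_derivative_compose[where g = F and f = "\<lambda>p. p + ?N", OF _ der[OF sub(2)[OF that]]])
         (auto intro!: derivative_eq_intros)
    then show ?thesis unfolding H_def
      by (rule has_derivative_diff[OF _ der[OF sub(1)[OF that]]])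
  qed
  have Hint: "intvec (lam (H p)) \<and> xc (H p) = 0 \<and> yc (H p) = 0" if "p \<in> ?U" for p
  proof -
    have "p + ?N = (lam p + n, xc p, yc p)" by (cases p) (auto simp: lam_def xc_def yc_def)
    then have "pt_eq (F (p + ?N)) (F p)"
      using lift n sub(1)[OF that] by (auto simp: is_lift_def)
    then show ?thesis by (simp add: H_def pt_eq_def tor_eq_def lam_def xc_def yc_def)
  qed
  have "continuous_on ?U H"
    using Hd has_derivative_continuous continuous_at_imp_continuous_on by blast
  then have Hc: "continuous_on ?U (\<lambda>p. lam (H p) $ i)" for i
    unfolding lam_def by (intro continuous_intros)
  have "(\<lambda>p. lam (H p) $ i) constant_on ?U" for i
  proof (rule continuous_discrete_range_constant[OF U(2) Hc])
    fix p assume p: "p \<in> ?U"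
    have "1 \<le> norm (lam (H p') $ i - lam (H p) $ i)"
      if "p' \<in> ?U" "lam (H p') $ i \<noteq> lam (H p) $ i" for p'
    proof -
      have "lam (H p') $ i - lam (H p) $ i \<in> \<int>"
        using Hint[OF p] Hint[OF that(1)] by (auto simp: intvec_def)
      then show ?thesis using that(2) Ints_nonzero_abs_ge1 by fastforce
    qed
    then show "\<exists>e>0. \<forall>p'. p' \<in> ?U \<and> lam (H p') $ i \<noteq> lam (H p) $ i \<longrightarrow>
        e \<le> norm (lam (H p') $ i - lam (H p) $ i)"
      using zero_less_one by blast
  qed
  then have "\<exists>c. \<forall>p\<in>?U. lam (H p) $ i = c" for i by (simp add: constant_on_def)
  then obtain l where l: "\<And>i p. p \<in> ?U \<Longrightarrow> lam (H p) $ i = l i" by metis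
  have "H p = ((\<chi> i. l i), 0, 0)" if "p \<in> ?U" for p
    using Hint[OF that] l[OF that] by (auto simp: prod_eq_iff lam_def xc_def yc_def vec_eq_iff)
  then obtain c where c: "\<And>p. p \<in> ?U \<Longrightarrow> H p = c" by blast
  have "(H has_derivative (\<lambda>v. 0)) (at z)"
    by (rule has_derivative_transform_within_open[OF has_derivative_const U(1) z]) (simp add: c)
  then have "(\<lambda>v. frechet_derivative F (at (z + ?N)) v - frechet_derivative F (at z) v) = (\<lambda>v. 0)"
    using has_derivative_unique Hd[OF z] by blast
  then show ?thesis by (auto simp: fun_eq_iff)
qed

text \<open>D is unbounded in the lifted torus direction, so compactness is available only after
  translating into a unit cell. Periodicity of the derivative justifies this in the interior, and
  boundary points follow by continuity. One direction v is treated at a time; finitely many basis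
  vectors then give the bound for all.\<close>

lemma frechet_derivative_bounded:
  fixes F :: "('c::finite,'u::finite,'s::finite) pt \<Rightarrow> ('c,'u,'s) pt"
  assumes R: "0 < R" and lift: "is_lift R F"
    and der: "\<And>z. z \<in> Dset R \<Longrightarrow> (F has_derivative frechet_derivative F (at z)) (at z)"
    and cont: "\<And>v. continuous_on (Dset R) (\<lambda>z. frechet_derivative F (at z) v)"
  shows "\<exists>B. \<forall>z\<in>Dset R. \<forall>v. norm (frechet_derivative F (at z) v) \<le> B * norm v"
proof -
  let ?U = "UNIV \<times> ball 0 R \<times> ball 0 R :: ('c,'u,'s) pt set"
  let ?K = "cbox 0 1 \<times> cball 0 R \<times> cball 0 R :: ('c,'u,'s) pt set"
  have clU: "closure ?U = Dset R" using R by (simp add: closure_Times Dset_def)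
  have "\<exists>B. \<forall>z\<in>Dset R. norm (frechet_derivative F (at z) v) \<le> B" for v
  proof -
    have "compact ?K" by (intro compact_Times compact_cbox compact_cball)
    moreover have "?K \<subseteq> Dset R" by (auto simp: Dset_def)
    ultimately have "bounded ((\<lambda>z. frechet_derivative F (at z) v) ` ?K)"
      by (intro compact_imp_bounded compact_continuous_image continuous_on_subset[OF cont])
    then obtain B where B: "\<And>z. z \<in> ?K \<Longrightarrow> norm (frechet_derivative F (at z) v) \<le> B"
      by (auto simp: bounded_iff)
    have "norm (frechet_derivative F (at z) v) \<le> B" if z: "z \<in> ?U" for z
    proof -
      \<comment> \<open>Adding n replaces each \<lambda>-component by its fractional part, which
        lies in the unit interval.\<close>
      define n :: "real^'c" where "n = (\<chi> i. - of_int \<lfloor>lam z $ i\<rfloor>)"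
      have "z + (n, 0, 0) \<in> ?K"
        using z by (cases z) (simp add: n_def lam_def mem_box_cart flip: frac_def,
            simp add: frac_lt_1 less_imp_le)
      moreover have "intvec n" by (auto simp: n_def intvec_def)
      ultimately show ?thesis
        using B frechet_derivative_periodic[OF lift der _ z] by metis
    qed
    then have "norm (frechet_derivative F (at z) v) \<le> B" if "z \<in> Dset R" for z
      using continuous_on_closure_norm_le[of ?U "\<lambda>z. frechet_derivative F (at z) v" B z] cont that clU
      by auto
    then show ?thesis by blast
  qed
  then obtain B where B: "\<And>v z. z \<in> Dset R \<Longrightarrow> norm (frechet_derivative F (at z) v) \<le> B v" by metis
  have "norm (frechet_derivative F (at z) v) \<le> (\<Sum>b\<in>Basis. B b) * norm v" if z: "z \<in> Dset R" for z v
  proof -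
    interpret linear "frechet_derivative F (at z)"
      using der[OF z] has_derivative_linear by blast
    have "frechet_derivative F (at z) v = frechet_derivative F (at z) (\<Sum>b\<in>Basis. (v \<bullet> b) *\<^sub>R b)"
      by (simp add: euclidean_representation)
    also have "\<dots> = (\<Sum>b\<in>Basis. (v \<bullet> b) *\<^sub>R frechet_derivative F (at z) b)"
      by (simp add: sum scale)
    also have "norm \<dots> \<le> (\<Sum>b\<in>Basis. norm v * B b)"
      by (rule sum_norm_le) (simp add: mult_mono B[OF z] Basis_le_norm)
    finally show ?thesis by (simp add: sum_distrib_left mult.commute)
  qed
  then show ?thesis by blast
qed

section \<open>Minimal expansion, block norms and rate constants\<close>

lemma mmin_works:
  fixes A :: "'a::euclidean_space \<Rightarrow> 'b::euclidean_space"
  shows "0 \<le> mmin A" and "mmin A * norm v \<le> norm (A v)"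
proof -
  let ?S = "{c. \<forall>v. c * norm v \<le> norm (A v)}"
  \<comment> \<open>A unit basis vector bounds the defining set from above and 0 belongs to it, so
    the real \<open>Sup\<close> is a genuine least upper bound.\<close>
  obtain b :: 'a where b: "b \<in> Basis" using nonempty_Basis by blast
  have bdd: "bdd_above ?S"
  proof (rule bdd_aboveI)
    fix c assume "c \<in> ?S"
    then have "c * norm b \<le> norm (A b)" by blast
    then show "c \<le> norm (A b)" using b by simp
  qed
  have 0: "0 \<in> ?S" by simp
  show "0 \<le> mmin A" unfolding mmin_def by (rule cSup_upper[OF 0 bdd])
  show "mmin A * norm v \<le> norm (A v)"
  proof (cases "v = 0")
    case False
    have "mmin A \<le> norm (A v) / norm v"
      unfolding mmin_def
    proof (rule cSup_least)
      show "?S \<noteq> {}" using 0 by blast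
    next
      fix c assume "c \<in> ?S"
      then have "c * norm v \<le> norm (A v)" by blast
      then show "c \<le> norm (A v) / norm v" using False by (simp add: field_simps)
    qed
    then show ?thesis using False by (simp add: field_simps)
  qed simp
qed

text \<open>The global derivative bound is what gives the suprema and infima over the noncompact set
  D their meaning.\<close>

locale lifted_map =
  fixes F :: "('c::finite,'u::finite,'s::finite) pt \<Rightarrow> ('c,'u,'s) pt" and R :: real
  assumes R_pos: "0 < R" and lift: "is_lift R F"
    and der: "\<And>z. z \<in> Dset R \<Longrightarrow> (F has_derivative frechet_derivative F (at z)) (at z)"
    and bounded: "\<exists>B. \<forall>z\<in>Dset R. \<forall>v. norm (frechet_derivative F (at z) v) \<le> B * norm v"
begin

abbreviation "dF z \<equiv> frechet_derivative F (at z)"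

text \<open>These are the ingredients of the rates: \<open>expansion_x - (1/L) * shear_x\<close> is
  \<open>xi_u1P\<close> and \<open>mu_ly L\<close> is \<open>mu_cs1\<close>, while
  \<open>expansion_x - M * shear_x\<close> and \<open>mu_ly (1/M)\<close> are \<xi> and \<mu> of the
  theorem.\<close>

definition "expansion_x = (INF z\<in>Dset R. mmin_set (imat (blk px ix F) (Pset R z)))"
definition "shear_x = (SUP z\<in>Dset R. onorm (blk px ily F z))"
definition "mu_ly K = (SUP z\<in>Dset R. onorm (blk ply ily F z) + K * onorm (blk ply ix F z))"

lemma Dset_nonempty: "(0 :: ('c,'u,'s) pt) \<in> Dset R"
  using R_pos by (simp add: Dset_iff xc_def yc_def)

lemma linear_dF: "z \<in> Dset R \<Longrightarrow> linear (dF z)"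
  using der has_derivative_linear by blast

lemma blk_linear: "z \<in> Dset R \<Longrightarrow> linear P \<Longrightarrow> linear I \<Longrightarrow> linear (blk P I F z)"
  unfolding blk_def by (rule linear_compose[OF _ linear_compose[OF linear_dF], unfolded o_assoc])

lemma norm_blk_le: "z \<in> Dset R \<Longrightarrow> linear P \<Longrightarrow> linear I \<Longrightarrow>
    norm (blk P I F z v) \<le> onorm (blk P I F z) * norm (v :: 'a::euclidean_space)"
  for P :: "_ \<Rightarrow> 'b::euclidean_space"
  by (rule onorm[OF linear_conv_bounded_linear[THEN iffD1, OF blk_linear]])

lemma onorm_blk_nonneg: "z \<in> Dset R \<Longrightarrow> linear P \<Longrightarrow> linear I \<Longrightarrow>
    0 \<le> onorm (blk P I F z :: 'a::euclidean_space \<Rightarrow> 'b::euclidean_space)"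
  by (rule onorm_pos_le[OF linear_conv_bounded_linear[THEN iffD1, OF blk_linear]])

text \<open>Coordinate projections do not increase the norm and coordinate inclusions preserve it,
  so every block inherits the bound of the full derivative.\<close>

lemma blk_bounded:
  fixes P :: "_ \<Rightarrow> 'b::euclidean_space" and I :: "'a::euclidean_space \<Rightarrow> _"
  assumes "\<And>v. norm (P v) \<le> norm v" "\<And>a. norm (I a) = norm a"
  shows "\<exists>B. \<forall>z\<in>Dset R. onorm (blk P I F z) \<le> B \<and> (\<forall>v. norm (blk P I F z v) \<le> B * norm v)"
proof -
  obtain B where B: "\<And>z v. z \<in> Dset R \<Longrightarrow> norm (dF z v) \<le> B * norm v" using bounded by blast
  have "norm (blk P I F z v) \<le> B * norm v" if "z \<in> Dset R" for z v
    using order_trans[OF assms(1) B[OF that, of "I v"]] by (simp add: blk_def assms(2))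
  then show ?thesis using onorm_le by blast
qed

lemma onorm_blk_bounded:
  fixes P :: "_ \<Rightarrow> 'b::euclidean_space" and I :: "'a::euclidean_space \<Rightarrow> _"
  assumes "\<And>v. norm (P v) \<le> norm v" "\<And>a. norm (I a) = norm a"
  obtains B where "\<And>z. z \<in> Dset R \<Longrightarrow> onorm (blk P I F z) \<le> B"
  using blk_bounded[of P I] assms by blast

lemma shear_x_ge: "z \<in> Dset R \<Longrightarrow> onorm (blk px ily F z) \<le> shear_x"
proof -
  obtain B where "\<And>z. z \<in> Dset R \<Longrightarrow> onorm (blk px ily F z) \<le> B"
    using onorm_blk_bounded[of px ily] norm_blocks by blast
  then show "z \<in> Dset R \<Longrightarrow> ?thesis"
    unfolding shear_x_def by (intro cSUP_upper bdd_aboveI2)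
qed

lemma shear_x_nonneg: "0 \<le> shear_x"
  using shear_x_ge[OF Dset_nonempty] onorm_blk_nonneg[OF Dset_nonempty linear_blocks(1,4)] by linarith

lemma mu_ly_ge:
  assumes "0 \<le> K" "z \<in> Dset R"
  shows "onorm (blk ply ily F z) + K * onorm (blk ply ix F z) \<le> mu_ly K"
proof -
  obtain B1 where B1: "\<And>z. z \<in> Dset R \<Longrightarrow> onorm (blk ply ily F z) \<le> B1"
    using onorm_blk_bounded[of ply ily] norm_blocks by blast
  obtain B2 where B2: "\<And>z. z \<in> Dset R \<Longrightarrow> onorm (blk ply ix F z) \<le> B2"
    using onorm_blk_bounded[of ply ix] norm_blocks by blast
  show ?thesis unfolding mu_ly_def
    by (intro cSUP_upper assms(2) bdd_aboveI2[of _ _ "B1 + K * B2"] add_mono mult_left_mono B1 B2 assms(1))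
qed

lemma mu_ly_nonneg: "0 \<le> K \<Longrightarrow> 0 \<le> mu_ly K"
  using onorm_blk_nonneg[OF Dset_nonempty linear_blocks(2,4)] mu_ly_ge[OF _ Dset_nonempty, of K]
    mult_nonneg_nonneg[OF _ onorm_blk_nonneg[OF Dset_nonempty linear_blocks(2,3)], of K] by linarith

section \<open>Mean value estimates for one application of the map\<close>

lemma mean_value_bound:
  fixes P :: "_ \<Rightarrow> 'b::euclidean_space"
  assumes P: "linear P" and pq: "p \<in> Dset R" "q \<in> Dset R"
    and T: "\<And>z. z \<in> Dset R \<Longrightarrow> norm (P (dF z (p - q))) \<le> T"
  shows "norm (P (F p - F q)) \<le> T"
proof -
  have seg: "q + t *\<^sub>R (p - q) \<in> Dset R" if "0 \<le> t" "t \<le> 1" for t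
    using convexD_alt[OF convex_Dset pq(2,1) that] by (simp add: algebra_simps)
  have d: "((\<lambda>t. P (F (q + t *\<^sub>R (p - q)))) has_derivative (\<lambda>h. P (dF (q + t *\<^sub>R (p - q)) (h *\<^sub>R (p - q))))) (at t)"
    if "0 \<le> t" "t \<le> 1" for t
    by (rule bounded_linear.has_derivative[OF linear_conv_bounded_linear[THEN iffD1, OF P]],
        rule has_derivative_compose[where g = F and f = "\<lambda>t. q + t *\<^sub>R (p - q)", OF _ der[OF seg[OF that]]])
       (auto intro!: derivative_eq_intros)
  have "continuous_on {0..1} (\<lambda>t. P (F (q + t *\<^sub>R (p - q))))"
    using d has_derivative_continuous by (intro continuous_at_imp_continuous_on) fastforce
  \<comment> \<open>For vector values the mean value theorem yields only an inequality of norms.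
    That is enough for upper bounds; the lower bound on the x-part works with scalar components
    instead.\<close>
  from mvt_general[OF zero_less_one this d]
  obtain t where "0 < t" "t < 1"
    "norm (P (F (q + 1 *\<^sub>R (p - q))) - P (F (q + 0 *\<^sub>R (p - q)))) \<le> norm (P (dF (q + t *\<^sub>R (p - q)) ((1 - 0) *\<^sub>R (p - q))))"
    by auto
  with T[OF seg[of t]] show ?thesis by (simp add: linear_diff[OF P])
qed

text \<open>T has to dominate the sum of both block terms at each single z. This fits
  \<open>mu_ly\<close>, a supremum of a sum, which may be smaller than the sum of the
  suprema.\<close>

lemma center_image_bound:
  assumes pq: "p \<in> Dset R" "q \<in> Dset R"
    and T: "\<And>z. z \<in> Dset R \<Longrightarrow>
      onorm (blk ply ily F z) * norm (ply (p - q)) + onorm (blk ply ix F z) * norm (px (p - q)) \<le> T"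
  shows "norm (ply (F p - F q)) \<le> T"
proof (rule mean_value_bound[OF linear_blocks(2) pq])
  fix z :: "('c,'u,'s) pt" assume z: "z \<in> Dset R"
  have "ply (dF z (p - q)) = ply (dF z (ily (ply (p - q)) + ix (px (p - q))))"
    by (simp flip: block_split)
  also have "\<dots> = blk ply ily F z (ply (p - q)) + blk ply ix F z (px (p - q))"
    unfolding blk_def o_def
    by (subst linear_add[OF linear_dF[OF z]], subst linear_add[OF linear_blocks(2)]) (rule refl)
  finally have "ply (dF z (p - q)) = blk ply ily F z (ply (p - q)) + blk ply ix F z (px (p - q))" .
  then show "norm (ply (dF z (p - q))) \<le> T"
    using norm_triangle_ineq[of "blk ply ily F z (ply (p - q))" "blk ply ix F z (px (p - q))"]
      norm_blk_le[OF z linear_blocks(2,4), of "ply (p - q)"]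
      norm_blk_le[OF z linear_blocks(2,3), of "px (p - q)"] T[OF z] by simp
qed

lemma x_block_entry_bounds:
  assumes "w \<in> Pset R p" "i \<in> Basis"
  shows "(INF y\<in>Pset R p. blk px ix F y j \<bullet> i) \<le> blk px ix F w j \<bullet> i"
    and "blk px ix F w j \<bullet> i \<le> (SUP y\<in>Pset R p. blk px ix F y j \<bullet> i)"
proof -
  obtain B where B: "\<And>z v. z \<in> Dset R \<Longrightarrow> norm (blk px ix F z v) \<le> B * norm v"
    using blk_bounded[of px ix] norm_blocks by blast
  have *: "\<bar>blk px ix F y j \<bullet> i\<bar> \<le> B * norm j" if "y \<in> Pset R p" for y
    using that order_trans[OF Basis_le_norm[OF assms(2)] B] by (auto simp: Pset_def)
  have "- (B * norm j) \<le> blk px ix F y j \<bullet> i" "blk px ix F y j \<bullet> i \<le> B * norm j"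
    if "y \<in> Pset R p" for y
    using *[OF that] by linarith+
  then have "bdd_below ((\<lambda>y. blk px ix F y j \<bullet> i) ` Pset R p)"
    "bdd_above ((\<lambda>y. blk px ix F y j \<bullet> i) ` Pset R p)"
    by (fast intro: bdd_belowI2 bdd_aboveI2)+
  then show "(INF y\<in>Pset R p. blk px ix F y j \<bullet> i) \<le> blk px ix F w j \<bullet> i"
    "blk px ix F w j \<bullet> i \<le> (SUP y\<in>Pset R p. blk px ix F y j \<bullet> i)"
    using cINF_lower[OF _ assms(1)] cSUP_upper[OF assms(1)] by blast+
qed

lemma expansion_x_le:
  assumes z: "z \<in> Dset R" and A: "A \<in> imat (blk px ix F) (Pset R z)"
  shows "expansion_x * norm v \<le> norm (A v)"
proof -
  \<comment> \<open>The block at w itself lies in the interval matrix. An infimum of nonnegative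
    reals over a nonempty set is nonnegative, which keeps the outer infimum bounded below.\<close>
  have ne: "imat (blk px ix F) (Pset R w) \<noteq> {}" if w: "w \<in> Dset R" for w
  proof -
    have "w \<in> Pset R w" using w by (simp add: Pset_def)
    then have "blk px ix F w \<in> imat (blk px ix F) (Pset R w)"
      using blk_linear[OF w linear_blocks(1,3)] by (simp add: imat_def x_block_entry_bounds)
    then show ?thesis by blast
  qed
  have nn: "0 \<le> mmin_set (imat (blk px ix F) (Pset R w))" if "w \<in> Dset R" for w
    unfolding mmin_set_def by (rule cINF_greatest[OF ne[OF that]]) (rule mmin_works)
  have "expansion_x \<le> mmin_set (imat (blk px ix F) (Pset R z))"
    unfolding expansion_x_def by (rule cINF_lower[OF bdd_belowI2[OF nn] z])
  also have "\<dots> \<le> mmin A"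
    unfolding mmin_set_def by (rule cINF_lower[OF bdd_belowI2[OF mmin_works(1)] A])
  finally have "expansion_x * norm v \<le> mmin A * norm v" by (rule mult_right_mono) simp
  with mmin_works(2) show ?thesis by (rule order_trans[rotated])
qed

text \<open>The rows of a matrix in the interval enclosure may be taken at different points, so the mean
  value theorem can be applied to each component of the x-part separately.\<close>

lemma expansion_along_x:
  assumes pq: "p \<in> Dset R" "q \<in> Dset R" and pl: "ply p = ply q"
  shows "expansion_x * norm (px (p - q)) \<le> norm (px (F p - F q))"
proof -
  obtain l x y x' where p: "p = (l, x, y)" and q: "q = (l, x', y)"
    using pl by (cases p, cases q) (auto simp: ply_def)
  have d: "p - q = ix (x - x')" by (simp add: p q ix_def)
  \<comment> \<open>Along the segment \<lambda> is constant, so it never leaves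
    \<open>Pset R p\<close>, the set over which the interval matrix is formed.\<close>
  have seg: "q + t *\<^sub>R (p - q) \<in> Pset R p" if "0 \<le> t" "t \<le> 1" for t
    using convexD_alt[OF convex_Dset pq(2,1) that] by (simp add: Pset_def algebra_simps) (simp add: p q lam_def)
  then have segD: "q + t *\<^sub>R (p - q) \<in> Dset R" if "0 \<le> t" "t \<le> 1" for t
    using that by (simp add: Pset_def)
  have "\<exists>w\<in>Pset R p. px (F p - F q) \<bullet> i = blk px ix F w (x - x') \<bullet> i" for i
  proof -
    have "linear (\<lambda>v. px v \<bullet> i)"
      using linear_compose[OF linear_blocks(1) bounded_linear.linear[OF bounded_linear_inner_left[of i]]]
      by (simp add: o_def)
    then have P: "bounded_linear (\<lambda>v :: ('c,'u,'s) pt. px v \<bullet> i)" by (simp add: linear_conv_bounded_linear)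
    have dd: "((\<lambda>t. px (F (q + t *\<^sub>R (p - q))) \<bullet> i) has_derivative
        (\<lambda>h. px (dF (q + t *\<^sub>R (p - q)) (h *\<^sub>R (p - q))) \<bullet> i)) (at t within {0..1})"
      if "0 \<le> t" "t \<le> 1" for t
      by (rule bounded_linear.has_derivative[OF P],
          rule has_derivative_compose[where g = F and f = "\<lambda>t. q + t *\<^sub>R (p - q)", OF _ der[OF segD[OF that]]])
         (auto intro!: derivative_eq_intros)
    from mvt_very_simple[OF zero_le_one dd]
    obtain t where t: "0 \<le> t" "t \<le> 1" and
      "px (F (q + 1 *\<^sub>R (p - q))) \<bullet> i - px (F (q + 0 *\<^sub>R (p - q))) \<bullet> i
        = px (dF (q + t *\<^sub>R (p - q)) ((1 - 0) *\<^sub>R (p - q))) \<bullet> i" by fastforce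
    moreover have "q + ix (x - x') = p" by (simp flip: d)
    ultimately have "px (F p - F q) \<bullet> i = blk px ix F (q + t *\<^sub>R (p - q)) (x - x') \<bullet> i"
      by (simp add: blk_def d linear_diff[OF linear_blocks(1)] inner_diff_left)
    then show ?thesis using seg[OF t] by blast
  qed
  then obtain w where w: "\<And>i. w i \<in> Pset R p"
    and wF: "\<And>i. px (F p - F q) \<bullet> i = blk px ix F (w i) (x - x') \<bullet> i" by metis
  have wD: "w i \<in> Dset R" for i using w by (auto simp: Pset_def)
  define A where "A v = (\<Sum>i\<in>Basis. (blk px ix F (w i) v \<bullet> i) *\<^sub>R i)" for v
  have Ai: "A v \<bullet> i = blk px ix F (w i) v \<bullet> i" if "i \<in> Basis" for v i
    unfolding A_def using that by simp
  have "linear A"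
    unfolding A_def using linear_add[OF blk_linear[OF wD linear_blocks(1,3)]]
      linear_cmul[OF blk_linear[OF wD linear_blocks(1,3)]]
    by (intro linearI) (simp_all add: inner_add_left scaleR_add_left sum.distrib scaleR_sum_right)
  then have "A \<in> imat (blk px ix F) (Pset R p)"
    using w by (simp add: imat_def Ai x_block_entry_bounds)
  from expansion_x_le[OF pq(1) this] have "expansion_x * norm (x - x') \<le> norm (A (x - x'))" .
  also have "A (x - x') = px (F p - F q)" by (rule euclidean_eqI) (simp add: Ai wF)
  finally show ?thesis by (simp add: p q px_def)
qed

text \<open>The corner point r takes x from q and the rest from p; it lies in D because D is a
  product. From p to r only x moves and the interval matrix expands; from r to q only \<lambda> and
  y move and the shear bounds the effect. The triangle inequality combines the two legs.\<close>

lemma x_image_bound: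
  assumes pq: "p \<in> Dset R" "q \<in> Dset R"
  shows "expansion_x * norm (px (p - q)) - shear_x * norm (ply (p - q)) \<le> norm (px (F p - F q))"
proof -
  define r where "r = (lam p, xc q, yc p)"
  have r: "r \<in> Dset R" using pq by (simp add: Dset_iff r_def xc_def yc_def)
  have "ply p = ply r" "px (p - r) = px (p - q)"
    by (simp_all add: r_def ply_def px_def lam_def xc_def yc_def)
  from expansion_along_x[OF pq(1) r this(1)] this(2)
  have 1: "expansion_x * norm (px (p - q)) \<le> norm (px (F p - F r))" by simp
  have e: "r - q = ily (ply (p - q))"
    by (cases p, cases q) (simp add: r_def ily_def ply_def lam_def xc_def yc_def)
  have 2: "norm (px (F r - F q)) \<le> shear_x * norm (ply (p - q))"
  proof (rule mean_value_bound[OF linear_blocks(1) r pq(2)])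
    fix z :: "('c,'u,'s) pt" assume z: "z \<in> Dset R"
    have "norm (px (dF z (r - q))) \<le> onorm (blk px ily F z) * norm (ply (p - q))"
      using norm_blk_le[OF z linear_blocks(1,4)] by (simp add: e blk_def)
    also have "\<dots> \<le> shear_x * norm (ply (p - q))"
      by (rule mult_right_mono[OF shear_x_ge[OF z]]) simp
    finally show "norm (px (dF z (r - q))) \<le> shear_x * norm (ply (p - q))" .
  qed
  have "px (F p - F q) = px (F p - F r) + px (F r - F q)" by (simp add: px_def)
  then have "norm (px (F p - F r)) \<le> norm (px (F p - F q)) + norm (px (F r - F q))"
    using norm_triangle_ineq4[of "px (F p - F q)" "px (F r - F q)"] by simp
  with 1 2 show ?thesis by linarith
qed

end

section \<open>Center-stable differences on the torus and their images\<close>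

definition gap :: "('c::finite,'u::finite,'s::finite) pt \<Rightarrow> ('c,'u,'s) pt \<Rightarrow> real^'c \<Rightarrow> (real^'c) \<times> (real^'s)"
  where "gap p q m = (lam p + m - lam q, yc p - yc q)"

lemma gap_diff: "gap p q (m - n) = gap p z m - gap q z n"
  by (simp add: gap_def)

text \<open>The two shifts differ by an integer vector of norm below 1, hence by 0. This later
  identifies the shift produced by one step of f with one chosen beforehand.\<close>

lemma gap_integer_unique:
  assumes "intvec m" "intvec n" "norm (gap p q m) < 1/2" "norm (gap p q n) < 1/2"
  shows "m = n"
proof -
  have "norm (m - n) \<le> norm (gap p q m - gap p q n)"
    using norm_fst_le[of "m - n" "0 :: real^'b"] by (simp add: gap_def)
  also have "\<dots> < 1" using norm_triangle_ineq4[of "gap p q m" "gap p q n"] assms(3,4) by linarith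
  finally show ?thesis using intvec_eq_0[OF intvec_diff[OF assms(1,2)]] by simp
qed

context lifted_map
begin

text \<open>The shift m selects the lift of p that is compared with q, and m' is the shift induced
  between p' and q'. The bound T is left open so that different cone widths can be inserted.\<close>

lemma image_step:
  assumes D: "p \<in> Dset R" "q \<in> Dset R" and img: "pt_eq (F p) p'" "pt_eq (F q) q'" and m: "intvec m"
  obtains m' where "intvec m'"
    and "expansion_x * norm (xc p - xc q) - shear_x * norm (gap p q m) \<le> norm (xc p' - xc q')"
    and "\<And>T. (\<And>z. z \<in> Dset R \<Longrightarrow> onorm (blk ply ily F z) * norm (gap p q m)
              + onorm (blk ply ix F z) * norm (xc p - xc q) \<le> T) \<Longrightarrow> norm (gap p' q' m') \<le> T"
proof -
  define P where "P = (lam p + m, xc p, yc p)"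
  \<comment> \<open>Three integer discrepancies are collected: shifting p before F is applied, and
    replacing each image by its representative p' or q'. With this choice
    \<open>gap p' q' m'\<close> is exactly the (\<lambda>, y)-part of
    \<open>F P - F q\<close>.\<close>
  define m' where "m' = (lam (F P) - lam (F p)) + (lam (F p) - lam p') - (lam (F q) - lam q')"
  have P: "P \<in> Dset R" using D by (simp add: Dset_iff P_def xc_def yc_def)
  have FP: "pt_eq (F P) (F p)" using lift m D(1) by (simp add: is_lift_def P_def)
  have 1: "px (P - q) = xc p - xc q" "ply (P - q) = gap p q m"
    by (simp_all add: P_def px_def ply_def gap_def lam_def xc_def yc_def)
  have 2: "px (F P - F q) = xc p' - xc q'" "ply (F P - F q) = gap p' q' m'"
    using FP img by (simp_all add: px_def ply_def gap_def m'_def pt_eq_def lam_def xc_def yc_def)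
  show ?thesis
  proof (rule that)
    show "intvec m'" unfolding m'_def
      using FP img by (intro intvec_add intvec_diff[of "_ + _"]) (simp_all add: pt_eq_def tor_eq_def)
  qed (use x_image_bound[OF P D(2)] center_image_bound[OF P D(2)] 1 2 in auto)
qed

end

section \<open>Contraction backward in time and shrinking cones\<close>

locale unstable_rates = lifted_map F R
  for F :: "('c::finite,'u::finite,'s::finite) pt \<Rightarrow> ('c,'u,'s) pt" and R :: real +
  fixes L M :: real
  assumes L_pos: "0 < L" and M_pos: "0 < M" and M_less: "M < 1/L"
    and expanding: "1 < expansion_x - (1/L) * shear_x"
    and rate_L: "mu_ly L < expansion_x - (1/L) * shear_x"
    and rate_M: "mu_ly (1/M) < expansion_x - M * shear_x"
begin

text \<open>The expansion rate on the cone of width 1/L, not the \<xi> of the theorem, which belongs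
  to width M.\<close>

definition "xi = expansion_x - (1/L) * shear_x"

lemma xi_rates: "1 < xi" "mu_ly L < xi"
  using expanding rate_L by (simp_all add: xi_def)

text \<open>Both sides of the rate inequality, multiplied by the cone width K, are compared at the
  endpoints M and 1/L; the left side is affine and the right side concave in K.\<close>

lemma uniform_rate:
  obtains \<theta> where "0 \<le> \<theta>" "\<theta> < 1"
    and "\<And>K z. M \<le> K \<Longrightarrow> K \<le> 1/L \<Longrightarrow> z \<in> Dset R \<Longrightarrow>
      onorm (blk ply ily F z) * K + onorm (blk ply ix F z) \<le> \<theta> * (K * (expansion_x - K * shear_x))"
proof -
  let ?x = "expansion_x - M * shear_x"
  define \<theta> where "\<theta> = max (mu_ly (1/M) / ?x) (mu_ly L / xi)"
  \<comment> \<open>A narrower cone loses less to shear: as M < 1/L, the rate at width M is at least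
    \<open>xi\<close>, which exceeds 1.\<close>
  have x: "0 < ?x" "0 < xi"
    using xi_rates(1) mult_right_mono[OF less_imp_le[OF M_less] shear_x_nonneg]
    unfolding xi_def by linarith+
  have nn: "0 \<le> mu_ly (1/M)" "0 \<le> mu_ly L"
    using mu_ly_nonneg L_pos M_pos by simp_all
  show ?thesis
  proof
    show th: "0 \<le> \<theta>" using nn x by (simp add: \<theta>_def le_max_iff_disj)
    show "\<theta> < 1" using xi_rates(2) rate_M x by (simp add: \<theta>_def)
    fix K :: real and z :: "('c,'u,'s) pt"
    assume K: "M \<le> K" "K \<le> 1/L" and z: "z \<in> Dset R"
    let ?C = "onorm (blk ply ily F z)" and ?D = "onorm (blk ply ix F z)"
    let ?l = "1/L"
    define t where "t = (K - M) / (?l - M)"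
    have t: "0 \<le> t" "t \<le> 1" using K M_less by (simp_all add: t_def)
    have Kt: "K = (1 - t) * M + t * ?l"
    proof -
      have "t * (?l - M) = K - M" using M_less by (simp add: t_def)
      then show ?thesis by (simp add: algebra_simps)
    qed
    have "mu_ly (1/M) \<le> \<theta> * ?x" "mu_ly L \<le> \<theta> * xi"
      using x by (simp_all add: \<theta>_def flip: pos_divide_le_eq)
    then have "?C + (1/M) * ?D \<le> \<theta> * ?x" "?C + L * ?D \<le> \<theta> * xi"
      using mu_ly_ge[OF _ z, of "1/M"] mu_ly_ge[OF _ z, of L] L_pos M_pos by simp_all
    from mult_left_mono[OF this(1), of M] mult_left_mono[OF this(2), of ?l]
    have "?C * M + ?D \<le> \<theta> * (M * ?x)" "?C * ?l + ?D \<le> \<theta> * (?l * xi)"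
      using L_pos M_pos by (simp_all add: algebra_simps)
    from add_mono[OF mult_left_mono[OF this(1), of "1 - t"] mult_left_mono[OF this(2) t(1)]]
    have "?C * K + ?D \<le> \<theta> * ((1 - t) * (M * ?x) + t * (?l * xi))"
      using t unfolding Kt by (simp add: algebra_simps)
    \<comment> \<open>The subtracted term is the exact height of the quadratic in K above its chord,
      and it is nonnegative.\<close>
    also have "(1 - t) * (M * ?x) + t * (?l * xi)
        = K * (expansion_x - K * shear_x) - shear_x * (t * (1 - t) * (?l - M)\<^sup>2)"
      unfolding Kt xi_def by algebra
    also have "\<theta> * \<dots> \<le> \<theta> * (K * (expansion_x - K * shear_x))"
      using t shear_x_nonneg th by (intro mult_left_mono) auto
    finally show "?C * K + ?D \<le> \<theta> * (K * (expansion_x - K * shear_x))" .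
  qed
qed

text \<open>In the cone of width 1/L the shear costs at most \<open>shear_x / L\<close> times the
  x-distance, so each forward step expands that distance by at least \<open>xi\<close>; the
  induction reads this backward.\<close>

lemma fiber_contraction:
  assumes D: "\<And>n. q n \<in> Dset R" "\<And>n. r n \<in> Dset R"
    and step: "\<And>n. pt_eq (F (q (Suc n))) (q n)" "\<And>n. pt_eq (F (r (Suc n))) (r n)"
    and cone: "\<And>n. Ju (r n) (1/L) (q n)"
  shows "xi ^ n * norm (xc (q n) - xc (r n)) \<le> norm (xc (q 0) - xc (r 0))"
proof (induction n)
  case (Suc n)
  obtain m where m: "intvec m"
    "norm (gap (q (Suc n)) (r (Suc n)) m) \<le> 1/L * norm (xc (q (Suc n)) - xc (r (Suc n)))"
    using cone[of "Suc n"] by (auto simp: Ju_def gap_def)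
  obtain m' where "expansion_x * norm (xc (q (Suc n)) - xc (r (Suc n)))
      - shear_x * norm (gap (q (Suc n)) (r (Suc n)) m) \<le> norm (xc (q n) - xc (r n))"
    using image_step[OF D step m(1)] by blast
  with mult_left_mono[OF m(2) shear_x_nonneg]
  have "xi * norm (xc (q (Suc n)) - xc (r (Suc n))) \<le> norm (xc (q n) - xc (r n))"
    by (simp add: xi_def algebra_simps)
  from mult_left_mono[OF this, of "xi ^ n"]
  have "xi ^ Suc n * norm (xc (q (Suc n)) - xc (r (Suc n))) \<le> xi ^ n * norm (xc (q n) - xc (r n))"
    using xi_rates(1) by (simp add: mult_ac)
  then show ?case using Suc by linarith
qed simp

text \<open>Gaps depend on an integer shift. The decay makes them eventually so small that f carries
  the shift chosen at one time to the shift chosen at the next, so beyond some time N their lengths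
  can be compared step by step.\<close>

lemma eventually_in_cone:
  assumes D: "\<And>n. q n \<in> Dset R" "\<And>n. r n \<in> Dset R"
    and step: "\<And>n. pt_eq (F (q (Suc n))) (q n)" "\<And>n. pt_eq (F (r (Suc n))) (r n)"
    and decay: "\<And>n. \<exists>m. intvec m \<and> norm (gap (q n) (r n) m) \<le> B / xi ^ n"
      "\<And>n. 1/L * norm (xc (q n) - xc (r n)) \<le> B / xi ^ n"
  obtains N where "\<And>n. N \<le> n \<Longrightarrow>
    \<exists>m. intvec m \<and> norm (gap (q n) (r n) m) \<le> 1/L * norm (xc (q n) - xc (r n))"
proof -
  obtain m where m: "\<And>n. intvec (m n)" "\<And>n. norm (gap (q n) (r n) (m n)) \<le> B / xi ^ n"
    using decay(1) by metis
  define e where "e n = norm (gap (q n) (r n) (m n))" for n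
  define X where "X n = norm (xc (q n) - xc (r n))" for n
  \<comment> \<open>A norm adapted to the cone of width 1/L: it equals \<open>e\<close> outside the
    cone and \<open>X / L\<close> inside.\<close>
  define \<rho> where "\<rho> n = max (e n) (1/L * X n)" for n
  let ?\<mu> = "mu_ly L"
  have \<mu>: "0 \<le> ?\<mu>" using mu_ly_nonneg L_pos by simp
  have \<rho>: "\<rho> n \<le> B / xi ^ n" for n
    using m(2) decay(2) by (simp add: \<rho>_def e_def X_def)
  \<comment> \<open>The factor \<open>max 1 ?\<mu>\<close> makes both \<open>\<rho>\<close> and
    \<open>?\<mu> * \<rho>\<close> fall below 1/2: the first bounds the chosen gap, the second the
    gap of the image.\<close>
  have "eventually (\<lambda>n. max 1 ?\<mu> * B / xi ^ n < 1/2) sequentially"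
    by (rule order_tendstoD[OF LIMSEQ_divide_realpow_zero[OF xi_rates(1)]]) simp
  then obtain N where N: "\<And>n. N \<le> n \<Longrightarrow> max 1 ?\<mu> * B / xi ^ n < 1/2"
    by (auto simp: eventually_sequentially)
  have small: "\<rho> n < 1/2" "?\<mu> * \<rho> n < 1/2" if "N \<le> n" for n
  proof -
    have \<rho>0: "0 \<le> \<rho> n" by (simp add: \<rho>_def e_def le_max_iff_disj)
    have "max 1 ?\<mu> * \<rho> n \<le> max 1 ?\<mu> * (B / xi ^ n)"
      by (intro mult_left_mono \<rho>) simp
    then have "max 1 ?\<mu> * \<rho> n < 1/2"
      using N[OF that] unfolding times_divide_eq_right by (rule le_less_trans)
    moreover have "1 * \<rho> n \<le> max 1 ?\<mu> * \<rho> n" "?\<mu> * \<rho> n \<le> max 1 ?\<mu> * \<rho> n"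
      using \<rho>0 by (intro mult_right_mono; simp)+
    ultimately show "\<rho> n < 1/2" "?\<mu> * \<rho> n < 1/2" by linarith+
  qed
  \<comment> \<open>Index n + 1 lies further back in time, so the implication is forward invariance
    of the cone; its contrapositive carries a failure at n to n + 1.\<close>
  have main: "e n \<le> ?\<mu> * \<rho> (Suc n) \<and> (e (Suc n) \<le> 1/L * X (Suc n) \<longrightarrow> e n \<le> 1/L * X n)"
    if n: "N \<le> n" for n
  proof -
    obtain m' where m': "intvec m'"
      and X': "expansion_x * X (Suc n) - shear_x * e (Suc n) \<le> X n"
      and T: "\<And>T. (\<And>z. z \<in> Dset R \<Longrightarrow> onorm (blk ply ily F z) * e (Suc n)
              + onorm (blk ply ix F z) * X (Suc n) \<le> T) \<Longrightarrow> norm (gap (q n) (r n) m') \<le> T"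
      using image_step[OF D step m(1)] unfolding e_def X_def by blast
    have g: "norm (gap (q n) (r n) m') \<le> ?\<mu> * \<rho> (Suc n)"
    proof (rule T)
      fix z :: "('c,'u,'s) pt" assume z: "z \<in> Dset R"
      let ?C = "onorm (blk ply ily F z)" and ?D = "onorm (blk ply ix F z)"
      have nn: "0 \<le> ?C" "0 \<le> ?D" using onorm_blk_nonneg[OF z] linear_blocks by blast+
      have "X (Suc n) \<le> L * \<rho> (Suc n)"
        using L_pos by (simp add: \<rho>_def field_simps max_def)
      then have "?C * e (Suc n) + ?D * X (Suc n) \<le> ?C * \<rho> (Suc n) + ?D * (L * \<rho> (Suc n))"
        by (intro add_mono mult_left_mono nn) (simp_all add: \<rho>_def)
      also have "\<dots> = (?C + L * ?D) * \<rho> (Suc n)" by (simp add: algebra_simps)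
      also have "\<dots> \<le> ?\<mu> * \<rho> (Suc n)"
        using mu_ly_ge[OF _ z, of L] L_pos
        by (intro mult_right_mono) (simp_all add: \<rho>_def e_def le_max_iff_disj)
      finally show "?C * e (Suc n) + ?D * X (Suc n) \<le> ?\<mu> * \<rho> (Suc n)" .
    qed
    have "norm (gap (q n) (r n) (m n)) < 1/2"
      using small(1)[OF n] by (simp only: \<rho>_def e_def max_less_iff_conj)
    moreover have "norm (gap (q n) (r n) m') < 1/2"
      using g small(2)[of "Suc n"] n by simp
    ultimately have "m' = m n" using gap_integer_unique[OF m' m(1)] by blast
    then have 1: "e n \<le> ?\<mu> * \<rho> (Suc n)" using g by (simp add: e_def)
    have "e n \<le> 1/L * X n" if c: "e (Suc n) \<le> 1/L * X (Suc n)"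
    proof -
      have "e n \<le> ?\<mu> * (1/L * X (Suc n))" using 1 c by (simp add: \<rho>_def max_def)
      also have "\<dots> \<le> xi * (1/L * X (Suc n))"
        using xi_rates(2) L_pos by (intro mult_right_mono) (simp_all add: X_def)
      also have "\<dots> = 1/L * (xi * X (Suc n))" by simp
      also have "xi * X (Suc n) \<le> X n"
        using X' mult_left_mono[OF c shear_x_nonneg] by (simp add: xi_def algebra_simps)
      finally show ?thesis using L_pos by (simp add: divide_right_mono)
    qed
    with 1 show ?thesis by blast
  qed
  have "e n \<le> 1/L * X n" if n: "N \<le> n" for n
  proof (rule ccontr)
    assume neg: "\<not> e n \<le> 1/L * X n"
    have out: "\<not> e (n + j) \<le> 1/L * X (n + j)" for j
      by (induction j) (use neg main n in auto)
    \<comment> \<open>Outside the cone \<open>\<rho>\<close> equals \<open>e\<close>, so the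
      one-step bound iterates in \<open>e\<close> alone. Combined with the decay at rate
      \<open>xi\<close> it leaves the vanishing factor \<open>(?\<mu> / xi) ^ j\<close>.\<close>
    have "e n \<le> ?\<mu> ^ j * e (n + j)" for j
    proof (induction j)
      case (Suc j)
      have "e (n + j) \<le> ?\<mu> * e (Suc (n + j))"
        using main[of "n + j"] out[of "Suc j"] n by (simp add: \<rho>_def max_def split: if_splits)
      from mult_left_mono[OF this, of "?\<mu> ^ j"] Suc \<mu> show ?case by (simp add: mult_ac)
    qed simp
    moreover have "?\<mu> ^ j * e (n + j) \<le> B * (?\<mu> / xi) ^ j" for j
    proof -
      have B: "0 \<le> B" using order_trans[OF norm_ge_zero m(2)[of 0]] by simp
      have "e (n + j) \<le> B / xi ^ (n + j)" using m(2) by (simp add: e_def)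
      also have "\<dots> \<le> B / xi ^ j"
        using xi_rates(1) B by (intro divide_left_mono power_increasing mult_pos_pos zero_less_power) auto
      finally have "?\<mu> ^ j * e (n + j) \<le> ?\<mu> ^ j * (B / xi ^ j)"
        using \<mu> by (intro mult_left_mono) auto
      then show ?thesis by (simp add: power_divide mult_ac)
    qed
    ultimately have "e n \<le> B * (?\<mu> / xi) ^ j" for j by (rule order_trans)
    moreover have "(\<lambda>j. B * (?\<mu> / xi) ^ j) \<longlonglongrightarrow> B * 0"
      using \<mu> xi_rates(2) xi_rates(1) by (intro tendsto_mult_left LIMSEQ_power_zero) simp
    \<comment> \<open>A gap of length 0 satisfies every cone condition, against the assumed failure
      at n.\<close>
    ultimately have "e n \<le> 0" using LIMSEQ_le_const by fastforce
    moreover have "0 \<le> 1/L * X n" using L_pos by (simp add: X_def)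
    ultimately show False using neg by linarith
  qed
  then show ?thesis using that[of N] m(1) unfolding e_def X_def by blast
qed

text \<open>After j forward steps the cone width is at most
  \<open>max M (\<theta> ^ j * (1/L))\<close>. The cap M from below keeps every width in the
  interval where the uniform rate holds. Only some integer shift is asked for, so the shift is
  simply carried along by f.\<close>

lemma cone_shrinks_to_M:
  assumes D: "\<And>n. q n \<in> Dset R" "\<And>n. r n \<in> Dset R"
    and step: "\<And>n. pt_eq (F (q (Suc n))) (q n)" "\<And>n. pt_eq (F (r (Suc n))) (r n)"
    and cone: "\<And>n. N \<le> n \<Longrightarrow>
      \<exists>m. intvec m \<and> norm (gap (q n) (r n) m) \<le> 1/L * norm (xc (q n) - xc (r n))"
  shows "\<exists>m. intvec m \<and> norm (gap (q 0) (r 0) m) \<le> M * norm (xc (q 0) - xc (r 0))"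
proof -
  obtain \<theta> where \<theta>: "0 \<le> \<theta>" "\<theta> < 1"
    and rate: "\<And>K z. M \<le> K \<Longrightarrow> K \<le> 1/L \<Longrightarrow> z \<in> Dset R \<Longrightarrow>
      onorm (blk ply ily F z) * K + onorm (blk ply ix F z) \<le> \<theta> * (K * (expansion_x - K * shear_x))"
    using uniform_rate by blast
  have "(\<lambda>n. \<theta> ^ n * (1/L)) \<longlonglongrightarrow> 0 * (1/L)"
    using \<theta> by (intro tendsto_mult_right LIMSEQ_power_zero) simp
  then have "eventually (\<lambda>n. \<theta> ^ n * (1/L) < M) sequentially"
    using M_pos by (intro order_tendstoD) auto
  \<comment> \<open>The starting time n is far enough back for the 1/L-cone to hold, and n steps
    suffice for the geometric width to fall below M.\<close>
  from eventually_happens[OF eventually_conj[OF eventually_ge_at_top[of N] this]]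
  obtain n where n: "N \<le> n" "\<theta> ^ n * (1/L) < M" by auto
  have "\<exists>m. intvec m \<and> norm (gap (q (n - j)) (r (n - j)) m)
      \<le> max M (\<theta> ^ j * (1/L)) * norm (xc (q (n - j)) - xc (r (n - j)))" if "j \<le> n" for j
    using that
  proof (induction j)
    case 0
    then show ?case using cone[OF n(1)] M_less by simp
  next
    case (Suc j)
    define i where "i = n - Suc j"
    have i: "n - j = Suc i" using Suc.prems by (simp add: i_def)
    define K where "K = max M (\<theta> ^ j * (1/L))"
    have "\<theta> ^ j * (1/L) \<le> 1 * (1/L)"
      using \<theta> L_pos by (intro mult_right_mono power_le_one) auto
    then have K: "M \<le> K" "K \<le> 1/L" using M_less by (simp_all add: K_def)
    let ?X = "norm (xc (q (Suc i)) - xc (r (Suc i)))"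
    obtain m where m: "intvec m" "norm (gap (q (Suc i)) (r (Suc i)) m) \<le> K * ?X"
      using Suc i by (auto simp: K_def)
    obtain m' where m': "intvec m'"
      and X': "expansion_x * ?X - shear_x * norm (gap (q (Suc i)) (r (Suc i)) m) \<le> norm (xc (q i) - xc (r i))"
      and T: "\<And>T. (\<And>z. z \<in> Dset R \<Longrightarrow> onorm (blk ply ily F z) * norm (gap (q (Suc i)) (r (Suc i)) m)
              + onorm (blk ply ix F z) * ?X \<le> T) \<Longrightarrow> norm (gap (q i) (r i) m') \<le> T"
      using image_step[OF D step m(1)] by blast
    have "norm (gap (q i) (r i) m') \<le> \<theta> * (K * (expansion_x - K * shear_x)) * ?X"
    proof (rule T)
      fix z :: "('c,'u,'s) pt" assume z: "z \<in> Dset R"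
      let ?C = "onorm (blk ply ily F z)" and ?D = "onorm (blk ply ix F z)"
      have "0 \<le> ?C" by (rule onorm_blk_nonneg[OF z linear_blocks(2,4)])
      from mult_left_mono[OF m(2) this] mult_right_mono[OF rate[OF K z], of ?X]
      show "?C * norm (gap (q (Suc i)) (r (Suc i)) m) + ?D * ?X
          \<le> \<theta> * (K * (expansion_x - K * shear_x)) * ?X"
        by (simp add: algebra_simps)
    qed
    \<comment> \<open>As the pair lies in the cone of width K, the last factor is at most the
      x-distance of the images; what remains is their new width,
      \<open>\<theta> * K\<close>.\<close>
    also have "\<dots> = (\<theta> * K) * ((expansion_x - K * shear_x) * ?X)" by simp
    also have "\<dots> \<le> (\<theta> * K) * norm (xc (q i) - xc (r i))"
      using X' mult_left_mono[OF m(2) shear_x_nonneg] \<theta>(1) K(1) M_pos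
      by (intro mult_left_mono) (auto simp: algebra_simps)
    also have "\<dots> \<le> max M (\<theta> ^ Suc j * (1/L)) * norm (xc (q i) - xc (r i))"
    proof (rule mult_right_mono)
      have "\<theta> * M \<le> 1 * M" using \<theta> M_pos by (intro mult_right_mono) auto
      then show "\<theta> * K \<le> max M (\<theta> ^ Suc j * (1/L))" by (auto simp: K_def max_def mult.assoc)
    qed simp
    finally show ?case using m' unfolding i_def by blast
  qed
  from this[of n] show ?thesis using n(2) by (simp add: max_def)
qed

section \<open>The Lipschitz bound for unstable fibers\<close>

lemma Wu_lipschitz:
  assumes z: "z \<in> Wcu R F" and p: "p \<in> Wu R L F z" "p' \<in> Wu R L F z"
  shows "\<exists>m. intvec m \<and> norm (gap p p' m) \<le> M * norm (xc p - xc p')"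
proof -
  obtain t where t: "back_traj R F z t" using z by (auto simp: Wcu_def)
  obtain q r where q: "back_traj R F p q" and r: "back_traj R F p' r" using p by (auto simp: Wu_def)
  note T = t[unfolded back_traj_def] q[unfolded back_traj_def] r[unfolded back_traj_def]
  \<comment> \<open>Membership in the fiber gives the cone condition only relative to backward
    orbits of z, so both orbits are first compared with the fixed orbit t. The constant 2 R bounds
    the x-distance of two points of D.\<close>
  have decay: "\<exists>m. intvec m \<and> norm (gap (s n) (t n) m) \<le> 2 * R / L / xi ^ n \<and>
      1/L * norm (xc (s n) - xc (t n)) \<le> 2 * R / L / xi ^ n"
    if s: "back_traj R F a s" "a \<in> Wu R L F z" for a s n
  proof -
    note S = s(1)[unfolded back_traj_def]
    have c: "Ju (t n) (1/L) (s n)" for n using s t by (auto simp: Wu_def)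
    have "xi ^ n * norm (xc (s n) - xc (t n)) \<le> norm (xc (s 0) - xc (t 0))"
      using S T(1) c by (intro fiber_contraction) auto
    also have "\<dots> \<le> norm (xc (s 0)) + norm (xc (t 0))" by (rule norm_triangle_ineq4)
    also have "\<dots> \<le> 2 * R" using S T(1) unfolding Dset_iff by (smt (verit))
    finally have "norm (xc (s n) - xc (t n)) \<le> 2 * R / xi ^ n"
      using xi_rates(1) by (simp add: field_simps)
    from mult_left_mono[OF this, of "1/L"] L_pos
    have x: "1/L * norm (xc (s n) - xc (t n)) \<le> 2 * R / L / xi ^ n" by (simp add: mult_ac)
    obtain m where "intvec m" "norm (gap (s n) (t n) m) \<le> 1/L * norm (xc (s n) - xc (t n))"
      using c[of n] by (auto simp: Ju_def gap_def)
    with x show ?thesis by (meson order_trans)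
  qed
  \<comment> \<open>Twice the bound on the distance to t, by the triangle inequality through
    t.\<close>
  define B where "B = 2 * (2 * R / L)"
  have "(\<exists>m. intvec m \<and> norm (gap (q n) (r n) m) \<le> B / xi ^ n) \<and>
      1/L * norm (xc (q n) - xc (r n)) \<le> B / xi ^ n" for n
  proof -
    let ?b = "2 * R / L / xi ^ n"
    have B: "B / xi ^ n = ?b + ?b" by (simp add: B_def)
    obtain m1 where m1: "intvec m1" "norm (gap (q n) (t n) m1) \<le> ?b" "1/L * norm (xc (q n) - xc (t n)) \<le> ?b"
      using decay[OF q p(1)] by blast
    obtain m2 where m2: "intvec m2" "norm (gap (r n) (t n) m2) \<le> ?b" "1/L * norm (xc (r n) - xc (t n)) \<le> ?b"
      using decay[OF r p(2)] by blast
    have "norm (gap (q n) (r n) (m1 - m2)) \<le> ?b + ?b"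
      unfolding gap_diff[of _ _ m1 m2 "t n"]
      by (rule order_trans[OF norm_triangle_ineq4 add_mono[OF m1(2) m2(2)]])
    moreover have "norm (xc (q n) - xc (r n)) \<le> norm (xc (q n) - xc (t n)) + norm (xc (r n) - xc (t n))"
      using norm_triangle_ineq4[of "xc (q n) - xc (t n)" "xc (r n) - xc (t n)"] by simp
    from mult_left_mono[OF this, of "1/L"] add_mono[OF m1(3) m2(3)] L_pos
    have "1/L * norm (xc (q n) - xc (r n)) \<le> ?b + ?b" by (simp add: algebra_simps)
    ultimately show ?thesis unfolding B using intvec_diff[OF m1(1) m2(1)] by blast
  qed
  then obtain N where "\<And>n. N \<le> n \<Longrightarrow>
      \<exists>m. intvec m \<and> norm (gap (q n) (r n) m) \<le> 1/L * norm (xc (q n) - xc (r n))"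
    using T by (elim eventually_in_cone[rotated -1]) auto
  then obtain m where m: "intvec m" "norm (gap (q 0) (r 0) m) \<le> M * norm (xc (q 0) - xc (r 0))"
    using cone_shrinks_to_M[of q r N] T by blast
  have e: "pt_eq (q 0) p" "pt_eq (r 0) p'" using T by blast+
  \<comment> \<open>Backward orbits start at p and p' only up to integer vectors, which m'
    absorbs.\<close>
  define m' where "m' = m + (lam (q 0) - lam p) - (lam (r 0) - lam p')"
  have "intvec m'" unfolding m'_def
    using e m(1) by (intro intvec_add intvec_diff[of "_ + _"]) (simp_all add: pt_eq_def tor_eq_def)
  moreover have "gap p p' m' = gap (q 0) (r 0) m" "xc (q 0) = xc p" "xc (r 0) = xc p'"
    using e by (simp_all add: gap_def m'_def pt_eq_def)
  ultimately show ?thesis using m(2) by metis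
qed

text \<open>The \<lambda>-values of w are lifts chosen separately for each x, so the estimate can
  hold only up to an integer vector n.\<close>

lemma graph_of_Wu_lipschitz:
  fixes w :: "real^'u \<Rightarrow> (real^'c) \<times> (real^'s)"
  assumes z: "z \<in> Wcu R F" and D: "\<And>x. x \<in> cball 0 R \<Longrightarrow> snd (w x) \<in> cball 0 R"
    and W: "\<And>p. p \<in> Dset R \<Longrightarrow> p \<in> Wu R L F z \<longleftrightarrow>
      tor_eq (lam p) (fst (w (xc p))) \<and> yc p = snd (w (xc p))"
    and x: "x1 \<in> cball 0 R" "x2 \<in> cball 0 R"
  shows "\<exists>n. intvec n \<and> norm (fst (w x1) - fst (w x2) + n, snd (w x1) - snd (w x2)) \<le> M * norm (x1 - x2)"
proof -
  have "(fst (w x), x, snd (w x)) \<in> Wu R L F z" if "x \<in> cball 0 R" for x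
  proof -
    have "(fst (w x), x, snd (w x)) \<in> Dset R" using D that by (simp add: Dset_def)
    with W show ?thesis by (simp add: lam_def xc_def yc_def tor_eq_refl)
  qed
  from Wu_lipschitz[OF z this[OF x(1)] this[OF x(2)]]
  obtain n where "intvec n" "norm (fst (w x1) + n - fst (w x2), snd (w x1) - snd (w x2)) \<le> M * norm (x1 - x2)"
    by (auto simp: gap_def lam_def xc_def yc_def)
  then show ?thesis by (intro exI[of _ n]) (simp add: diff_add_eq)
qed

end

lemma (in lifted_map) unstable_ratesI:
  assumes "0 < L" "0 < M" "M < 1/L"
    and "1 < xi_u1P R L F" "mu_cs1 R L F < xi_u1P R L F"
    and quot: "1 < (expansion_x - M * shear_x) / mu_ly (1/M)"
  shows "unstable_rates F R L M"
proof
  show "1 < expansion_x - (1/L) * shear_x" "mu_ly L < expansion_x - (1/L) * shear_x"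
    using assms(4,5)
    by (simp_all add: xi_u1P_def mu_cs1_def expansion_x_def shear_x_def mu_ly_def)
  \<comment> \<open>Division by zero gives 0, so a quotient above 1 forces
    \<open>mu_ly (1/M)\<close> to be nonzero, hence positive, and the inequality can be multiplied
    out.\<close>
  have "mu_ly (1/M) \<noteq> 0" using quot by auto
  then have "0 < mu_ly (1/M)" using mu_ly_nonneg[of "1/M"] assms(2) by simp
  with quot show "mu_ly (1/M) < expansion_x - M * shear_x" by simp
qed (fact assms)+

theorem theorem3p3:
  fixes F :: "('c::finite,'u::finite,'s::finite) pt \<Rightarrow> ('c,'u,'s) pt"
    and R L M :: real and k :: nat
  assumes "1 \<le> k"
    and "0 < R" and "R < 1/4"
    and "2 * R / (1/2) < L" and "L < 1"
    and "is_lift R F"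
    and "Ck_on_D (k+1) R F"
    and "covering_conditions R L F"
    and "rate_conditions k R L F"
    and "backward_cone_conditions R L F"
    and "0 < M" and "M < 1/L"
    and "(let xi = (INF z\<in>Dset R. mmin_set (imat (blk px ix F) (Pset R z)))
                   - M * (SUP z\<in>Dset R. onorm (blk px ily F z));
              mu = (SUP z\<in>Dset R. onorm (blk ply ily F z) + (1/M) * onorm (blk ply ix F z))
          in xi / mu > 1)"
  shows "\<forall>z\<in>Wcu R F. \<forall>w :: real^'u \<Rightarrow> (real^'c) \<times> (real^'s).
           ((\<forall>x\<in>cball 0 R. snd (w x) \<in> cball 0 R) \<and>
            (\<forall>p\<in>Dset R. p \<in> Wu R L F z \<longleftrightarrow>
                 tor_eq (lam p) (fst (w (xc p))) \<and> yc p = snd (w (xc p))))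
           \<longrightarrow> (\<forall>x1\<in>cball 0 R. \<forall>x2\<in>cball 0 R. \<exists>n. intvec n \<and>
                 norm (fst (w x1) - fst (w x2) + n, snd (w x1) - snd (w x2)) \<le> M * norm (x1 - x2))"
proof -
  note C = continuous_on_frechet_derivative_of_Ck[OF assms(7,1)]
  have lm: "lifted_map F R"
    by (rule lifted_map.intro[OF assms(2,6) C(1) frechet_derivative_bounded[OF assms(2,6) C]])
  \<comment> \<open>Positivity of L comes from 4 R < L and R > 0.\<close>
  have "unstable_rates F R L M"
    using assms(2,4,9,11,12,13)
    by (intro lifted_map.unstable_ratesI[OF lm])
       (simp_all add: rate_conditions_def Let_def lifted_map.expansion_x_def[OF lm]
          lifted_map.shear_x_def[OF lm] lifted_map.mu_ly_def[OF lm])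
  then show ?thesis
    by (intro ballI allI impI) (rule unstable_rates.graph_of_Wu_lipschitz, auto)
qed

end
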